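(* There exists a $9$-atomic positive measure $\mu$ supported in $\mathbb{R}_+$ such that $\mu*t\mu$ has a positive square root, while $\mu$ has no positive square root.
   Context: $\mathbb{R}_+=[0,+\infty)$. A positive measure is $p$-atomic if it is of the form $\sum_{k=1}^p a_k\delta_{x_k}$ with $x_1,\dots,x_p$ distinct and all $a_k>0$. The multiplicative convolution of two finite measures is $[\nu*\mu](E)=\int\int\chi_E(xy)\,d\nu(x)\,d\mu(y)$, so $\delta_a*\delta_b=\delta_{ab}$. $t\mu$ denotes the measure with $d(t\mu)(t)=t\,d\mu(t)$. A positive square root of a measure $\eta$ is a finite positive measure $\nu$ supported in $\mathbb{R}_+$ with $\nu*\nu=\eta$. *)

theory Defs
  imports "HOL-Probability.Probability"
begin

definition atomic_measure :: "nat \<Rightarrow> real measure \<Rightarrow> bool" where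
  "atomic_measure p \<mu> \<longleftrightarrow>
     sets \<mu> = sets borel \<and>
     (\<exists>(a :: nat \<Rightarrow> real) (x :: nat \<Rightarrow> real).
        inj_on x {1..p} \<and> (\<forall>k\<in>{1..p}. 0 < a k) \<and>
        (\<forall>E\<in>sets borel. emeasure \<mu> E =
           (\<Sum>k=1..p. ennreal (a k) * emeasure (return borel (x k)) E)))"

(* For a Borel measure on the line, the closed support lies in [0, \<infinity>) iff the open
   half-line (-\<infinity>, 0) is null. *)
definition supported_nonneg :: "real measure \<Rightarrow> bool" where
  "supported_nonneg \<mu> \<longleftrightarrow> emeasure \<mu> {..<0} = 0"

(* The push-forward of the product measure under multiplication; the multiplicative analogue
   of the library's additive convolution.  The double integral formula and the action on
   Dirac measures are derived below. *)
definition mult_convolution :: "real measure \<Rightarrow> real measure \<Rightarrow> real measure" (infix "\<star>\<^sub>m" 70) where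
  "\<nu> \<star>\<^sub>m \<mu> = distr (\<nu> \<Otimes>\<^sub>M \<mu>) borel (\<lambda>(x, y). x * y)"

(* ennreal truncates negative reals to 0, so this is t d\<mu>(t) for \<mu> supported in [0, \<infinity>). *)
definition t_measure :: "real measure \<Rightarrow> real measure" where
  "t_measure \<mu> = density \<mu> (\<lambda>t. ennreal t)"

definition positive_square_root :: "real measure \<Rightarrow> real measure \<Rightarrow> bool" where
  "positive_square_root \<nu> \<eta> \<longleftrightarrow>
     finite_measure \<nu> \<and> sets \<nu> = sets borel \<and> supported_nonneg \<nu> \<and> \<nu> \<star>\<^sub>m \<nu> = \<eta>"

lemma emeasure_mult_convolution:
  assumes "finite_measure \<nu>" "finite_measure \<mu>"
    and [measurable_cong]: "sets \<nu> = sets borel" "sets \<mu> = sets borel"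
    and [measurable]: "E \<in> sets borel"
  shows "emeasure (\<nu> \<star>\<^sub>m \<mu>) E = (\<integral>\<^sup>+y. \<integral>\<^sup>+x. indicator E (x * y) \<partial>\<nu> \<partial>\<mu>)"
proof -
  interpret \<nu>: finite_measure \<nu> by fact
  interpret \<mu>: finite_measure \<mu> by fact
  interpret pair_sigma_finite \<nu> \<mu> ..
  have "emeasure (\<nu> \<star>\<^sub>m \<mu>) E = (\<integral>\<^sup>+z. indicator E z \<partial>(\<nu> \<star>\<^sub>m \<mu>))"
    by (simp add: mult_convolution_def)
  also have "\<dots> = (\<integral>\<^sup>+z. indicator E (fst z * snd z) \<partial>(\<nu> \<Otimes>\<^sub>M \<mu>))"
    unfolding mult_convolution_def by (subst nn_integral_distr) (auto simp: case_prod_beta)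
  also have "\<dots> = (\<integral>\<^sup>+y. \<integral>\<^sup>+x. indicator E (x * y) \<partial>\<nu> \<partial>\<mu>)"
    by (subst nn_integral_snd[symmetric]) auto
  finally show ?thesis .
qed

lemma mult_convolution_return:
  "return borel a \<star>\<^sub>m return borel b = return borel (a * b)"
proof (rule measure_eqI)
  show "sets (return borel a \<star>\<^sub>m return borel b) = sets (return borel (a * b))"
    by (simp add: mult_convolution_def)
  fix E assume "E \<in> sets (return borel a \<star>\<^sub>m return borel b)"
  then have [measurable]: "E \<in> sets borel" by (simp add: mult_convolution_def)
  have "finite_measure (return borel c)" for c :: real
    by (simp add: prob_space_return prob_space.finite_measure)
  then show "emeasure (return borel a \<star>\<^sub>m return borel b) E = emeasure (return borel (a * b)) E"
    by (subst emeasure_mult_convolution) (simp_all add: nn_integral_return)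
qed

end

(* A measure with atoms at powers of 2 is a polynomial p, the atom at 2^k carrying the
   coefficient of X^k. Multiplicative convolution is multiplication of polynomials, and t_measure
   is the substitution of 2X for X. Take p = s^2 for s = 2 + 4X - X^2 + 4X^3 + 2X^4. All
   coefficients of p(X) and of s(X) s(2X) are positive, and p(X) p(2X) = (s(X) s(2X))^2. A
   positive square root of p would have to agree with s in its three lowest coefficients, but s has
   a negative one there. *)

theory Submission
  imports Defs
begin

text \<open>Coefficients are natural numbers, so that an equality between such measures comes down
  to an identity in \<open>nat\<close>.\<close>

definition dyadic :: "nat list \<Rightarrow> real measure" where
  "dyadic cs = distr (density (count_space {..<length cs}) (\<lambda>k. of_nat (cs ! k))) borel (\<lambda>k. 2 ^ k)"

lemma sets_dyadic [simp, measurable_cong]: "sets (dyadic cs) = sets borel"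
  by (simp add: dyadic_def)

lemma space_dyadic [simp]: "space (dyadic cs) = UNIV"
  by (simp add: dyadic_def)

lemma nn_integral_dyadic:
  assumes [measurable]: "f \<in> borel_measurable borel"
  shows "(\<integral>\<^sup>+x. f x \<partial>dyadic cs) = (\<Sum>k<length cs. of_nat (cs ! k) * f (2 ^ k))"
  unfolding dyadic_def
  by (simp add: nn_integral_distr nn_integral_density nn_integral_count_space_finite)

lemma emeasure_dyadic:
  assumes "E \<in> sets borel"
  shows "emeasure (dyadic cs) E = (\<Sum>k<length cs. of_nat (cs ! k) * indicator E (2 ^ k))"
  using assms nn_integral_dyadic[of "indicator E" cs] by simp

lemma finite_measure_dyadic: "finite_measure (dyadic cs)"
  by (rule finite_measureI) (simp add: emeasure_dyadic ennreal_mult_eq_top_iff less_top)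

lemma supported_nonneg_dyadic: "supported_nonneg (dyadic cs)"
  by (simp add: supported_nonneg_def emeasure_dyadic indicator_def)

lemma t_measure_dyadic:
  "t_measure (dyadic cs) = dyadic (map (\<lambda>k. cs ! k * 2 ^ k) [0..<length cs])"
proof (rule measure_eqI)
  fix E assume "E \<in> sets (t_measure (dyadic cs))"
  then have [measurable]: "E \<in> sets borel" by (simp add: t_measure_def)
  \<comment> \<open>The density contributes the cast of a real power, the new coefficients a power
    taken in \<open>ennreal\<close>.\<close>
  have "ennreal (2 ^ k) = 2 ^ k" for k
    by (metis ennreal_numeral ennreal_power zero_le_numeral)
  then show "emeasure (t_measure (dyadic cs)) E
      = emeasure (dyadic (map (\<lambda>k. cs ! k * 2 ^ k) [0..<length cs])) E"
    by (simp add: t_measure_def emeasure_density nn_integral_dyadic emeasure_dyadic mult.assoc)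
qed (simp add: t_measure_def)

text \<open>Collecting everything under one \<open>of_nat\<close> allows two convolutions to be
  compared without arithmetic in \<open>ennreal\<close>.\<close>

lemma emeasure_dyadic_convolution:
  assumes [measurable]: "E \<in> sets borel"
  shows "emeasure (dyadic as \<star>\<^sub>m dyadic bs) E =
    of_nat (\<Sum>j<length bs. bs ! j * (\<Sum>i<length as. as ! i * indicator E (2 ^ (i + j) :: real)))"
  by (subst emeasure_mult_convolution)
    (simp_all add: finite_measure_dyadic nn_integral_dyadic power_add indicator_def of_bool_def
      if_distrib[of of_nat] cong: if_cong)

lemma atomic_measure_dyadic:
  assumes "0 \<notin> set cs"
  shows "atomic_measure (length cs) (dyadic cs)"
  unfolding atomic_measure_def
proof (intro conjI exI ballI)
  \<comment> \<open>Atoms are numbered from 1 and list entries from 0, hence the shift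
    \<open>k - 1\<close>.\<close>
  show "inj_on (\<lambda>k. 2 ^ (k - 1) :: real) {1..length cs}"
    by (auto simp: inj_on_def)
  show "0 < real (cs ! (k - 1))" if "k \<in> {1..length cs}" for k
  proof -
    have "cs ! (k - 1) \<in> set cs" using that by (intro nth_mem) auto
    then show ?thesis using assms by (metis gr0I of_nat_0_less_iff)
  qed
  show "emeasure (dyadic cs) E = (\<Sum>k = 1..length cs. ennreal (real (cs ! (k - 1))) *
      emeasure (return borel (2 ^ (k - 1))) E)" if "E \<in> sets borel" for E
    unfolding emeasure_dyadic[OF that] using that
    by (intro sum.reindex_bij_witness[of _ "\<lambda>k. k - 1" Suc]) (auto simp: ennreal_of_nat_eq_real_of_nat)
qed simp

text \<open>The coefficients of p = s^2, lowest degree first.\<close>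

definition example_coeffs :: "nat list" where
  "example_coeffs = [4, 16, 12, 8, 41, 8, 12, 16, 4]"

text \<open>The coefficients of s(X) s(2X), where s(2X) = 2 + 8X - 4X^2 + 32X^3 + 32X^4. The
  negative terms are outweighed; at X^2, for instance, -8 + 32 - 2 = 22.\<close>

definition root_coeffs :: "nat list" where
  "root_coeffs = [4, 24, 22, 48, 232, 96, 88, 192, 64]"

lemma t_measure_example:
  "t_measure (dyadic example_coeffs) = dyadic [4, 32, 48, 64, 656, 256, 768, 2048, 1024]"
  by (simp add: t_measure_dyadic example_coeffs_def upt_rec)

lemma root_coeffs_convolution:
  "dyadic root_coeffs \<star>\<^sub>m dyadic root_coeffs =
    dyadic example_coeffs \<star>\<^sub>m t_measure (dyadic example_coeffs)"
proof (rule measure_eqI)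
  fix E assume "E \<in> sets (dyadic root_coeffs \<star>\<^sub>m dyadic root_coeffs)"
  then have E: "E \<in> sets borel" by (simp add: mult_convolution_def)
  \<comment> \<open>With \<open>g\<close> opaque, both sides expand to linear combinations of
    \<open>g 0\<close>, ..., \<open>g 16\<close>. Comparing them is comparing the coefficients of
    (s(X) s(2X))^2 and p(X) p(2X).\<close>
  define g where "g k = (indicator E (2 ^ k :: real) :: nat)" for k
  show "emeasure (dyadic root_coeffs \<star>\<^sub>m dyadic root_coeffs) E
      = emeasure (dyadic example_coeffs \<star>\<^sub>m t_measure (dyadic example_coeffs)) E"
    unfolding t_measure_example emeasure_dyadic_convolution[OF E] g_def[symmetric]
    by (rule arg_cong[where f = of_nat])
      (simp add: root_coeffs_def example_coeffs_def sum.lessThan_Suc_shift del: sum.lessThan_Suc)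
qed (simp add: mult_convolution_def)

text \<open>This form allows the convolution to be estimated by rectangles in the plane.\<close>

lemma emeasure_mult_convolution_pair:
  assumes [measurable_cong]: "sets \<nu> = sets borel" and [measurable]: "E \<in> sets borel"
  shows "emeasure (\<nu> \<star>\<^sub>m \<nu>) E = emeasure (\<nu> \<Otimes>\<^sub>M \<nu>) {z. fst z * snd z \<in> E}"
proof -
  have "space (\<nu> \<Otimes>\<^sub>M \<nu>) = UNIV"
    using sets_eq_imp_space_eq[OF assms(1)] by (simp add: space_pair_measure)
  then show ?thesis
    unfolding mult_convolution_def
    by (subst emeasure_distr) (auto simp: case_prod_beta vimage_def)
qed

text \<open>A root \<nu> is an arbitrary measure, so mass below 1 and between 1 and 2 is excluded
  first. Then the atoms of the square at 1 and 2 force \<nu> to have mass 2 at 1 and 4 at 2. This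
  would put mass at least 16 at 4, where p has only 12.\<close>

lemma no_positive_square_root_example: "\<not> positive_square_root \<nu> (dyadic example_coeffs)"
proof
  assume sqrt: "positive_square_root \<nu> (dyadic example_coeffs)"
  then interpret finite_measure \<nu> by (simp add: positive_square_root_def)
  have [simp, measurable_cong]: "sets \<nu> = sets borel"
    using sqrt by (simp add: positive_square_root_def)
  have neg: "emeasure \<nu> {..<0} = 0"
    using sqrt by (simp add: positive_square_root_def supported_nonneg_def)
  let ?P = "\<nu> \<Otimes>\<^sub>M \<nu>"
  have rect: "emeasure ?P (A \<times> B) = emeasure \<nu> A * emeasure \<nu> B"
    if "A \<in> sets borel" "B \<in> sets borel" for A B
    using that by (simp add: emeasure_pair_measure_Times)
  have rect_sets: "A \<times> B \<in> sets ?P" if "A \<in> sets borel" "B \<in> sets borel" for A B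
    using that by (intro pair_measureI) simp_all
  have conv: "emeasure ?P {z. fst z * snd z \<in> E} = emeasure (dyadic example_coeffs) E"
    if "E \<in> sets borel" for E
    using sqrt that by (simp add: positive_square_root_def flip: emeasure_mult_convolution_pair)
  have product_set: "{z. fst z * snd z \<in> E} \<in> sets ?P" if [measurable]: "E \<in> sets borel" for E
  proof -
    have "space ?P = UNIV"
      using sets_eq_imp_space_eq[of \<nu> borel] by (simp add: space_pair_measure)
    moreover have "{z \<in> space ?P. fst z * snd z \<in> E} \<in> sets ?P" by measurable
    ultimately show ?thesis by simp
  qed
  \<comment> \<open>The rectangle \<open>A \<times> B\<close> lies in the preimage of
    \<open>E\<close> under multiplication.\<close>
  have lower: "emeasure \<nu> A * emeasure \<nu> B \<le> emeasure (dyadic example_coeffs) E"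
    if "A \<in> sets borel" "B \<in> sets borel" "E \<in> sets borel"
      "\<And>x y. x \<in> A \<Longrightarrow> y \<in> B \<Longrightarrow> x * y \<in> E" for A B E
    unfolding rect[OF that(1,2), symmetric] conv[OF that(3), symmetric]
    using that by (intro emeasure_mono product_set) auto
  have atoms: "emeasure (dyadic example_coeffs) {1} = 4" "emeasure (dyadic example_coeffs) {2} = 16"
      "emeasure (dyadic example_coeffs) {4} = 12" "emeasure (dyadic example_coeffs) {0..<1} = 0"
      "emeasure (dyadic example_coeffs) {1<..<2} = 0"
    by (simp_all add: emeasure_dyadic example_coeffs_def sum.lessThan_Suc_shift del: sum.lessThan_Suc)
  \<comment> \<open>\<open>{0..<1}\<close> is closed under multiplication and contains no power of
    2.\<close>
  have "emeasure \<nu> {0..<1} * emeasure \<nu> {0..<1} \<le> emeasure (dyadic example_coeffs) {0..<1}"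
    using mult_strict_mono'[of _ 1 _ 1] by (intro lower) fastforce+
  then have "emeasure \<nu> {0..<1} = 0" by (simp add: atoms)
  moreover have "emeasure \<nu> {..<1} \<le> emeasure \<nu> {..<0} + emeasure \<nu> {0..<1}"
    by (rule order_trans[OF emeasure_mono emeasure_subadditive]) auto
  ultimately have small: "emeasure \<nu> {..<1} = 0" by (simp add: neg)
  \<comment> \<open>Converse estimate: outside the two null strips over \<open>N\<close>, the
    preimage of \<open>E\<close> is contained in \<open>R\<close>.\<close>
  have upper: "emeasure (dyadic example_coeffs) E \<le> emeasure ?P R"
    if null: "emeasure \<nu> N = 0" and "N \<in> sets borel" "E \<in> sets borel" "R \<in> sets ?P"
      and cover: "\<And>x y. x * y \<in> E \<Longrightarrow> x \<notin> N \<Longrightarrow> y \<notin> N \<Longrightarrow> (x, y) \<in> R" for E R N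
  proof -
    have "N \<times> UNIV \<in> sets ?P" "UNIV \<times> N \<in> sets ?P"
      by (simp_all add: rect_sets \<open>N \<in> sets borel\<close>)
    have "emeasure (dyadic example_coeffs) E \<le> emeasure ?P (R \<union> (N \<times> UNIV \<union> UNIV \<times> N))"
      unfolding conv[OF that(3), symmetric]
    proof (rule emeasure_mono)
      show "{z. fst z * snd z \<in> E} \<subseteq> R \<union> (N \<times> UNIV \<union> UNIV \<times> N)"
        using cover by force
    qed (intro sets.Un; fact)
    also have "\<dots> \<le> emeasure ?P R + (emeasure ?P (N \<times> UNIV) + emeasure ?P (UNIV \<times> N))"
      by (intro order_trans[OF emeasure_subadditive] add_left_mono emeasure_subadditive sets.Un; fact?) simp
    also have "\<dots> = emeasure ?P R"
      by (simp add: rect null \<open>N \<in> sets borel\<close>)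
    finally show ?thesis .
  qed
  \<comment> \<open>Two factors that are at least 1 have product 1 only if both equal 1.\<close>
  have "emeasure (dyadic example_coeffs) {1} \<le> emeasure ?P ({1} \<times> {1})"
  proof (rule upper[OF small])
    fix x y :: real assume "x * y \<in> {1}" "x \<notin> {..<1}" "y \<notin> {..<1}"
    then have "x * y = 1" "1 \<le> x" "1 \<le> y" by auto
    moreover have "x \<le> x * y" "y \<le> x * y" using \<open>1 \<le> x\<close> \<open>1 \<le> y\<close> by auto
    ultimately show "(x, y) \<in> {1} \<times> {1}" by auto
  qed (rule sets.Un rect_sets | simp)+
  then have one_ge: "4 \<le> emeasure \<nu> {1} * emeasure \<nu> {1}"
    using rect[of "{1}" "{1}"] by (simp add: atoms)
  \<comment> \<open>Multiplication by 1 keeps \<open>{1<..<2}\<close> in place, and the atom at 1 is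
    nonzero by \<open>one_ge\<close>.\<close>
  have "emeasure \<nu> {1} * emeasure \<nu> {1<..<2} \<le> emeasure (dyadic example_coeffs) {1<..<2}"
    by (rule lower) auto
  then have gap: "emeasure \<nu> {1<..<2} = 0" using one_ge by (auto simp: atoms)
  \<comment> \<open>Off \<open>?N\<close> each factor is 1 or at least 2. Two factors of the latter
    kind give at least 4, so product 2 leaves only (1, 2) and (2, 1).\<close>
  let ?N = "{..<1} \<union> {1<..<2} :: real set"
  have "emeasure \<nu> ?N = 0"
    using emeasure_subadditive[of "{..<1}" \<nu> "{1<..<2}"] by (simp add: small gap)
  then have "emeasure (dyadic example_coeffs) {2} \<le> emeasure ?P ({1} \<times> {2} \<union> {2} \<times> {1})"
  proof (rule upper)
    fix x y :: real assume "x * y \<in> {2}" "x \<notin> ?N" "y \<notin> ?N"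
    then have xy: "x * y = 2" "x = 1 \<or> 2 \<le> x" "y = 1 \<or> 2 \<le> y" by auto
    then have "\<not> (2 \<le> x \<and> 2 \<le> y)" using mult_mono[of 2 x 2 y] by auto
    with xy show "(x, y) \<in> {1} \<times> {2} \<union> {2} \<times> {1}" by auto
  qed (rule sets.Un rect_sets | simp)+
  also have "\<dots> \<le> emeasure ?P ({1} \<times> {2}) + emeasure ?P ({2} \<times> {1})"
    by (intro emeasure_subadditive rect_sets) simp_all
  finally have two_ge: "16 \<le> emeasure \<nu> {1} * emeasure \<nu> {2} + emeasure \<nu> {2} * emeasure \<nu> {1}"
    using rect[of "{1}" "{2}"] rect[of "{2}" "{1}"] by (simp add: atoms)
  have one_le: "emeasure \<nu> {1} * emeasure \<nu> {1} \<le> 4"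
    unfolding atoms(1)[symmetric] by (rule lower) auto
  \<comment> \<open>The point (2, 2) alone already contributes to the atom at 4.\<close>
  have two_le: "emeasure \<nu> {2} * emeasure \<nu> {2} \<le> 12"
    unfolding atoms(3)[symmetric] by (rule lower) auto
  define a b where "a = measure \<nu> {1}" and "b = measure \<nu> {2}"
  have nonneg: "0 \<le> a" "0 \<le> b" by (simp_all add: a_def b_def)
  have "ennreal (a * a) \<le> ennreal 4" "ennreal (b * b) \<le> ennreal 12"
      "ennreal 16 \<le> ennreal (a * b + b * a)"
    using one_le two_le two_ge nonneg
    by (simp_all add: emeasure_eq_measure ennreal_mult mult.commute mult_2 flip: a_def b_def)
  then have le: "a * a \<le> 4" "b * b \<le> 12" "8 \<le> a * b"
    using nonneg by (simp_all add: ennreal_le_iff del: ennreal_numeral)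
  \<comment> \<open>Squaring \<open>8 \<le> a * b\<close> brings in both upper bounds at once: 64
    would be at most 48.\<close>
  have "(8::real) * 8 \<le> (a * b) * (a * b)" using le(3) by (intro mult_mono) auto
  also have "\<dots> = (a * a) * (b * b)" by simp
  also have "\<dots> \<le> 4 * 12" using le nonneg by (intro mult_mono) auto
  finally show False by simp
qed

theorem mainTheorem2:
  shows "\<exists>\<mu> :: real measure.
    atomic_measure 9 \<mu> \<and> supported_nonneg \<mu> \<and>
    (\<exists>\<nu>. positive_square_root \<nu> (\<mu> \<star>\<^sub>m t_measure \<mu>)) \<and>
    \<not> (\<exists>\<nu>. positive_square_root \<nu> \<mu>)"
proof (intro exI conjI)
  have "length example_coeffs = 9" by (simp add: example_coeffs_def)
  moreover have "0 \<notin> set example_coeffs" by (simp add: example_coeffs_def)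
  ultimately show "atomic_measure 9 (dyadic example_coeffs)"
    using atomic_measure_dyadic by metis
  show "positive_square_root (dyadic root_coeffs)
      (dyadic example_coeffs \<star>\<^sub>m t_measure (dyadic example_coeffs))"
    by (simp add: positive_square_root_def root_coeffs_convolution finite_measure_dyadic
      supported_nonneg_dyadic)
qed (use no_positive_square_root_example supported_nonneg_dyadic in auto)

end
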